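(* Let $n\ge3$. If $\mathcal{C}\subseteq\mathcal{H}^{(n)}=(\mathbb{C}^2)^{\otimes n}$ is an $\mathfrak{so}(2n+1)$ spinorial code of distance $2$ (a quantum code of distance $2$ for the $\mathfrak{so}(2n+1)$ spinorial quantum metric), then $\dim(\mathcal{C})\le\frac{2^{n-1}}{n+1}$.
   Context: Spinorial quantum metric: with Pauli matrices $\sigma_x,\sigma_y,\sigma_z$, put $U_k=\sigma_z^{\otimes k-1}\otimes\sigma_x\otimes I_2^{\otimes n-k}$ and $U_{n+k}=\sigma_z^{\otimes k-1}\otimes\sigma_y\otimes I_2^{\otimes n-k}$ for $1\le k\le n$, and $U_{2n+1}=\sigma_z^{\otimes n}$. Let $\mathcal{E}=\operatorname{span}(\{I\}\cup\{U_kU_l:1\le k<l\le2n+1\})$; the $\mathfrak{so}(2n+1)$ spinorial quantum metric is $\mathcal{E}_t=\mathbb{C}I$ for $0\le t<1$ and $\mathcal{E}_t=\mathcal{E}^{\lfloor t\rfloor}$ (span of products of $\lfloor t\rfloor$ elements of $\mathcal{E}$) for $t\ge1$. A quantum code is a subspace $\mathcal{C}$ with orthogonal projection $P$; it detects an operator $E$ if $PEP$ is a scalar multiple of $P$; its distance is the largest $d$ such that it detects all $E\in\mathcal{E}_{d-1}$. *)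

theory Defs
  imports Complex_Main "Jordan_Normal_Form.Matrix" "Jordan_Normal_Form.Conjugate"
    "Jordan_Normal_Form.VS_Connect"
begin

text \<open>
  The space $(\mathbb{C}^2)^{\otimes n}$ is identified with $\mathbb{C}^{2^n}$, that is with
  \<^term>\<open>carrier_vec (2 ^ n)\<close>, through the Kronecker product; operators are complex
  \<open>2 ^ n\<close> by \<open>2 ^ n\<close> matrices.
\<close>

definition kron :: "complex mat \<Rightarrow> complex mat \<Rightarrow> complex mat" where
  "kron A B = mat (dim_row A * dim_row B) (dim_col A * dim_col B)
     (\<lambda>(i, j). A $$ (i div dim_row B, j div dim_col B) * B $$ (i mod dim_row B, j mod dim_col B))"

definition kron_list :: "complex mat list \<Rightarrow> complex mat" where
  "kron_list As = foldr kron As (1\<^sub>m 1)"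

definition sigma_x :: "complex mat" where
  "sigma_x = mat_of_rows_list 2 [[0, 1], [1, 0]]"

definition sigma_y :: "complex mat" where
  "sigma_y = mat_of_rows_list 2 [[0, - \<i>], [\<i>, 0]]"

definition sigma_z :: "complex mat" where
  "sigma_z = mat_of_rows_list 2 [[1, 0], [0, - 1]]"

text \<open>The generators are indexed by \<open>1 \<le> k \<le> 2 * n + 1\<close>; other values of \<open>k\<close> are never used.\<close>

definition spin_gen :: "nat \<Rightarrow> nat \<Rightarrow> complex mat" where
  "spin_gen n k =
     (if k \<le> n then
        kron_list (replicate (k - 1) sigma_z @ [sigma_x] @ replicate (n - k) (1\<^sub>m 2))
      else if k \<le> 2 * n then
        kron_list (replicate (k - n - 1) sigma_z @ [sigma_y] @ replicate (n - (k - n)) (1\<^sub>m 2))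
      else kron_list (replicate n sigma_z))"

definition mat_span :: "nat \<Rightarrow> complex mat set \<Rightarrow> complex mat set" where
  "mat_span N S = LinearCombinations.module.span class_ring (module_mat TYPE(complex) N N) S"

definition mat_set_power :: "nat \<Rightarrow> complex mat set \<Rightarrow> nat \<Rightarrow> complex mat set" where
  "mat_set_power N S m =
     mat_span N {foldr (*) As (1\<^sub>m N) | As. length As = m \<and> set As \<subseteq> S}"

definition spin_space :: "nat \<Rightarrow> complex mat set" where
  "spin_space n = mat_span (2 ^ n)
     ({1\<^sub>m (2 ^ n)} \<union> {spin_gen n k * spin_gen n l | k l. 1 \<le> k \<and> k < l \<and> l \<le> 2 * n + 1})"

text \<open>Only arguments \<open>t \<ge> 0\<close> are meaningful.\<close>

definition spin_metric :: "nat \<Rightarrow> real \<Rightarrow> complex mat set" where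
  "spin_metric n t =
     (if t < 1 then mat_span (2 ^ n) {1\<^sub>m (2 ^ n)}
      else mat_set_power (2 ^ n) (spin_space n) (nat \<lfloor>t\<rfloor>))"

definition quantum_code :: "nat \<Rightarrow> complex vec set \<Rightarrow> bool" where
  "quantum_code N C \<longleftrightarrow> VectorSpace.subspace class_ring C (module_vec TYPE(complex) N)"

definition code_dim :: "nat \<Rightarrow> complex vec set \<Rightarrow> nat" where
  "code_dim N C = vectorspace.dim class_ring ((module_vec TYPE(complex) N)\<lparr>carrier := C\<rparr>)"

definition is_orth_proj :: "nat \<Rightarrow> complex vec set \<Rightarrow> complex mat \<Rightarrow> bool" where
  "is_orth_proj N C P \<longleftrightarrow> P \<in> carrier_mat N N \<and>
     (\<forall>v \<in> carrier_vec N. P *\<^sub>v v \<in> C \<and> (\<forall>w \<in> C. (v - P *\<^sub>v v) \<bullet>c w = 0))"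

definition detects :: "nat \<Rightarrow> complex vec set \<Rightarrow> complex mat \<Rightarrow> bool" where
  "detects N C E \<longleftrightarrow> (\<exists>P. is_orth_proj N C P \<and> (\<exists>c. P * E * P = c \<cdot>\<^sub>m P))"

text \<open>
  \<open>d\<close> is the largest integer such that \<open>C\<close> detects all of \<open>F (d - 1)\<close>, where \<open>F\<close> is a quantum
  metric on the operators of size \<open>N\<close>. No such \<open>d\<close> exists if \<open>C\<close> detects every operator
  of the metric.
\<close>

definition has_distance ::
  "nat \<Rightarrow> (real \<Rightarrow> complex mat set) \<Rightarrow> complex vec set \<Rightarrow> nat \<Rightarrow> bool" where
  "has_distance N F C d \<longleftrightarrow>
     1 \<le> d \<and> (\<forall>E \<in> F (real d - 1). detects N C E) \<and>
     (\<forall>d' > d. \<not> (\<forall>E \<in> F (real d' - 1). detects N C E))"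

end

theory Submission
  imports Defs "Jordan_Normal_Form.Schur_Decomposition" "Jordan_Normal_Form.DL_Rank"
begin

text \<open>
  This is a linear programming bound. Conjugation by the anticommuting unitaries \<open>U k\<close> gives
  commuting self-adjoint involutions of the space of operators, and their sum \<open>\<Psi>\<close> satisfies
  \<open>\<parallel>\<Psi> X\<parallel> \<ge> \<parallel>X\<parallel>\<close> because the number \<open>m = 2 * n + 1\<close> of involutions is odd. The identity and the
  products \<open>U k * U l\<close> are orthogonal eigenvectors of \<open>\<Psi>\<close> with eigenvalues \<open>m\<close> and \<open>m - 4\<close>.
  Splitting off these components of the code projection \<open>P\<close> bounds \<open>\<parallel>\<Psi> P\<parallel>\<^sup>2 - \<parallel>P\<parallel>\<^sup>2\<close> from below, while the
  detection conditions \<open>P * (U k * U l) * P = c \<cdot>\<^sub>m P\<close> evaluate it exactly in terms of the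
  components of \<open>P\<close> along the \<open>U k * U l\<close>. Comparing the two sides bounds the trace of \<open>P\<close>.
\<close>

subsection \<open>The Hilbert--Schmidt inner product\<close>

definition mat_trace :: "complex mat \<Rightarrow> complex" where
  "mat_trace A = (\<Sum>i<dim_row A. A $$ (i, i))"

lemma mat_trace_mult:
  assumes "A \<in> carrier_mat n m" and "B \<in> carrier_mat m n"
  shows "mat_trace (A * B) = (\<Sum>i<n. \<Sum>j<m. A $$ (i, j) * B $$ (j, i))"
  using assms by (auto simp: mat_trace_def scalar_prod_def lessThan_atLeast0 intro!: sum.cong)

lemma mat_trace_comm:
  assumes "A \<in> carrier_mat n m" and "B \<in> carrier_mat m n"
  shows "mat_trace (A * B) = mat_trace (B * A)"
  unfolding mat_trace_mult[OF assms] mat_trace_mult[OF assms(2,1)]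
  by (subst sum.swap) (simp add: mult.commute)

lemma mat_trace_smult: "mat_trace (c \<cdot>\<^sub>m A) = c * mat_trace A" if "A \<in> carrier_mat n n"
  using that by (simp add: mat_trace_def sum_distrib_left)

lemma mat_trace_one: "mat_trace (1\<^sub>m n) = of_nat n"
  by (simp add: mat_trace_def)

lemma mat_adjoint_carrier [simp]: "A \<in> carrier_mat n m \<Longrightarrow> mat_adjoint A \<in> carrier_mat m n"
  by (auto simp: mat_adjoint_def)

lemma mat_adjoint_index [simp]:
  "i < dim_col A \<Longrightarrow> j < dim_row A \<Longrightarrow> mat_adjoint A $$ (i, j) = conjugate (A $$ (j, i))"
  by (simp add: mat_adjoint_def mat_of_rows_def)

lemma mat_adjoint_dim [simp]:
  "dim_row (mat_adjoint A) = dim_col A" "dim_col (mat_adjoint A) = dim_row A"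
  by (simp_all add: mat_adjoint_def)

lemma mat_adjoint_mult:
  fixes A B :: "complex mat"
  assumes "A \<in> carrier_mat n m" and "B \<in> carrier_mat m k"
  shows "mat_adjoint (A * B) = mat_adjoint B * mat_adjoint A"
  using assms by (intro eq_matI) (auto simp: scalar_prod_def mult.commute intro!: sum.cong)

lemma mat_adjoint_smult: "mat_adjoint (c \<cdot>\<^sub>m A) = cnj c \<cdot>\<^sub>m mat_adjoint (A :: complex mat)"
  by (intro eq_matI) auto

lemma mat_adjoint_one: "mat_adjoint (1\<^sub>m n) = (1\<^sub>m n :: complex mat)"
  by (intro eq_matI) auto

lemma smult_smult_mat: "a \<cdot>\<^sub>m (b \<cdot>\<^sub>m A) = (a * b) \<cdot>\<^sub>m (A :: 'a :: semigroup_mult mat)"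
  by (intro eq_matI) (auto simp: mult.assoc)

lemma one_smult_mat: "1 \<cdot>\<^sub>m A = (A :: 'a :: monoid_mult mat)"
  by (intro eq_matI) auto

text \<open>Taking the real part gives a real inner product, so that norms and coefficients can be
  compared by inequalities. Between self-adjoint operators the trace is real anyway, so nothing is
  lost for \<open>P\<close> and the operators it is tested against.\<close>

definition hs_inner :: "complex mat \<Rightarrow> complex mat \<Rightarrow> real" where
  "hs_inner A B = Re (mat_trace (A * mat_adjoint B))"

lemma hs_inner_sum:
  assumes "A \<in> carrier_mat n n" and "B \<in> carrier_mat n n"
  shows "hs_inner A B = (\<Sum>i<n. \<Sum>j<n. Re (A $$ (i, j) * cnj (B $$ (i, j))))"
proof -
  have "mat_trace (A * mat_adjoint B) = (\<Sum>i<n. \<Sum>j<n. A $$ (i, j) * cnj (B $$ (i, j)))"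
    using assms by (subst mat_trace_mult[of _ n n]) (auto intro!: sum.cong)
  then show ?thesis by (simp add: hs_inner_def del: times_complex.sel)
qed

lemma hs_inner_commute:
  assumes "A \<in> carrier_mat n n" and "B \<in> carrier_mat n n"
  shows "hs_inner A B = hs_inner B A"
  unfolding hs_inner_sum[OF assms] hs_inner_sum[OF assms(2,1)] by (simp add: mult.commute)

lemma hs_inner_self_nonneg: "A \<in> carrier_mat n n \<Longrightarrow> 0 \<le> hs_inner A A"
  by (simp add: hs_inner_sum sum_nonneg)

lemma hs_inner_add_left:
  assumes "A \<in> carrier_mat n n" "B \<in> carrier_mat n n" "C \<in> carrier_mat n n"
  shows "hs_inner (A + B) C = hs_inner A C + hs_inner B C"
  using assms by (simp add: hs_inner_sum[of _ n] algebra_simps sum.distrib)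

lemma hs_inner_minus_left:
  assumes "A \<in> carrier_mat n n" "B \<in> carrier_mat n n" "C \<in> carrier_mat n n"
  shows "hs_inner (A - B) C = hs_inner A C - hs_inner B C"
  using assms by (simp add: hs_inner_sum[of _ n] minus_carrier_mat algebra_simps sum.distrib sum_subtractf)

lemma hs_inner_smult_left:
  assumes "A \<in> carrier_mat n n" "B \<in> carrier_mat n n"
  shows "hs_inner (complex_of_real c \<cdot>\<^sub>m A) B = c * hs_inner A B"
  using assms by (simp add: hs_inner_sum[of _ n] algebra_simps sum_distrib_left)

lemma hs_inner_add_right:
  assumes "A \<in> carrier_mat n n" "B \<in> carrier_mat n n" "C \<in> carrier_mat n n"
  shows "hs_inner C (A + B) = hs_inner C A + hs_inner C B"
  using assms by (simp add: hs_inner_sum[of _ n] algebra_simps sum.distrib)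

lemma hs_inner_minus_right:
  assumes "A \<in> carrier_mat n n" "B \<in> carrier_mat n n" "C \<in> carrier_mat n n"
  shows "hs_inner C (A - B) = hs_inner C A - hs_inner C B"
  using assms by (simp add: hs_inner_sum[of _ n] minus_carrier_mat algebra_simps sum.distrib sum_subtractf)

lemma hs_inner_smult_right:
  assumes "A \<in> carrier_mat n n" "B \<in> carrier_mat n n"
  shows "hs_inner A (complex_of_real c \<cdot>\<^sub>m B) = c * hs_inner A B"
  using assms by (simp add: hs_inner_sum[of _ n] algebra_simps sum_distrib_left)

lemmas hs_inner_simps = hs_inner_add_left hs_inner_minus_left hs_inner_smult_left
  hs_inner_add_right hs_inner_minus_right hs_inner_smult_right

subsection \<open>Conjugation by anticommuting unitaries\<close>

lemma sum_square_symmetric: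
  fixes f :: "nat \<Rightarrow> nat \<Rightarrow> real"
  assumes "\<And>k l. f k l = f l k"
  shows "(\<Sum>k<m. \<Sum>l<m. f k l) = (\<Sum>k<m. f k k) + 2 * (\<Sum>(k, l)\<in>{(k, l). k < l \<and> l < m}. f k l)"
proof -
  let ?L = "\<lambda>m. {(k, l). k < l \<and> l < (m::nat)}"
  have fin: "finite (?L m)" for m
    by (rule finite_subset[of _ "{..<m} \<times> {..<m}"]) auto
  have step: "?L (Suc m) = ?L m \<union> (\<lambda>k. (k, m)) ` {..<m}" for m by auto
  have "(\<Sum>(k, l)\<in>?L (Suc m). f k l) = (\<Sum>(k, l)\<in>?L m. f k l) + (\<Sum>k<m. f k m)" for m
    unfolding step using fin by (subst sum.union_disjoint) (auto simp: sum.reindex inj_on_def)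
  then show ?thesis
    by (induct m) (simp_all add: sum.distrib assms[of m for m])
qed

text \<open>Indices start at 0. Only anticommutation is restricted to indices below
  \<open>m\<close>: the operators stay self-adjoint involutions for larger ones, where
  \<open>spin_gen\<close> keeps returning its last value, and this spares side conditions.\<close>

locale clifford_family =
  fixes N m :: nat and U :: "nat \<Rightarrow> complex mat"
  assumes U_carrier [simp]: "U k \<in> carrier_mat N N"
    and U_adjoint [simp]: "mat_adjoint (U k) = U k"
    and U_square [simp]: "U k * U k = 1\<^sub>m N"
    and U_anticommute:
      "k < m \<Longrightarrow> l < m \<Longrightarrow> k \<noteq> l \<Longrightarrow> U k * U l = - 1 \<cdot>\<^sub>m (U l * U k)"
begin

abbreviation "M \<equiv> carrier_mat N N :: complex mat set"

definition conj_by :: "nat \<Rightarrow> complex mat \<Rightarrow> complex mat" where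
  "conj_by k X = U k * X * U k"

text \<open>\<open>conj_sum 0 m\<close> is the operator \<Psi> of the overview. The scalar
  \<open>a\<close> collects involutions already replaced by their eigenvalues, and \<open>k\<close>
  counts the remaining ones.\<close>

primrec conj_sum :: "real \<Rightarrow> nat \<Rightarrow> complex mat \<Rightarrow> complex mat" where
  "conj_sum a 0 X = complex_of_real a \<cdot>\<^sub>m X"
| "conj_sum a (Suc k) X = conj_sum a k X + conj_by k X"

lemma mult_M [simp]: "A \<in> M \<Longrightarrow> B \<in> M \<Longrightarrow> A * B \<in> M"
  by simp

lemma minus_M [simp]: "B \<in> M \<Longrightarrow> A - B \<in> M"
  by (rule minus_carrier_mat)

lemma conj_by_carrier [simp]: "X \<in> M \<Longrightarrow> conj_by k X \<in> M"
  by (simp add: conj_by_def)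

lemma conj_sum_carrier [simp]: "X \<in> M \<Longrightarrow> conj_sum a k X \<in> M"
  by (induct k) simp_all

lemma conj_by_dim [simp]:
  "X \<in> M \<Longrightarrow> dim_row (conj_by k X) = N" "X \<in> M \<Longrightarrow> dim_col (conj_by k X) = N"
  using conj_by_carrier by blast+

lemma conj_sum_dim [simp]:
  "X \<in> M \<Longrightarrow> dim_row (conj_sum a k X) = N" "X \<in> M \<Longrightarrow> dim_col (conj_sum a k X) = N"
  using conj_sum_carrier by blast+

lemma U_cancel: "X \<in> M \<Longrightarrow> U k * (U k * X) = X"
  by (simp flip: assoc_mult_mat[of _ N N _ N _ N])

lemma conj_by_conj_by [simp]: "X \<in> M \<Longrightarrow> conj_by k (conj_by k X) = X"
  by (simp add: conj_by_def assoc_mult_mat[of _ N N _ N _ N] U_cancel)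

lemma conj_by_add: "X \<in> M \<Longrightarrow> Y \<in> M \<Longrightarrow> conj_by k (X + Y) = conj_by k X + conj_by k Y"
  by (simp add: conj_by_def mult_add_distrib_mat[of _ N N _ N] add_mult_distrib_mat[of _ N N _ _ N])

lemma conj_by_minus: "X \<in> M \<Longrightarrow> Y \<in> M \<Longrightarrow> conj_by k (X - Y) = conj_by k X - conj_by k Y"
  by (simp add: conj_by_def mult_minus_distrib_mat[of _ N N _ N] minus_mult_distrib_mat[of _ N N _ _ N])

lemma conj_by_smult: "X \<in> M \<Longrightarrow> conj_by k (c \<cdot>\<^sub>m X) = c \<cdot>\<^sub>m conj_by k X"
  by (simp add: conj_by_def mult_smult_distrib[of _ N N _ N] mult_smult_assoc_mat[of _ N N _ N])

text \<open>Exchanging \<open>U k\<close> and \<open>U l\<close> costs a sign on each side of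
  \<open>X\<close>, and the two signs cancel.\<close>

lemma conj_by_commute:
  assumes "k < m" "l < m" "X \<in> M"
  shows "conj_by k (conj_by l X) = conj_by l (conj_by k X)"
proof (cases "k = l")
  case False
  have "conj_by k (conj_by l X) = (U k * U l) * X * (U l * U k)"
    using assms by (simp add: conj_by_def assoc_mult_mat[of _ N N _ N _ N])
  also have "\<dots> = (- 1 \<cdot>\<^sub>m (U l * U k)) * X * (- 1 \<cdot>\<^sub>m (U k * U l))"
    using U_anticommute[OF assms(1,2) False] U_anticommute[OF assms(2,1) False[symmetric]]
    by (intro arg_cong2[of _ _ _ _ "(*)"] refl) simp_all
  also have "\<dots> = (U l * U k) * X * (U k * U l)"
    using assms by (simp add: mult_smult_distrib[of _ N N _ N] mult_smult_assoc_mat[of _ N N _ N]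
        smult_smult_mat one_smult_mat del: assoc_mult_mat)
  also have "\<dots> = conj_by l (conj_by k X)"
    using assms by (simp add: conj_by_def assoc_mult_mat[of _ N N _ N _ N])
  finally show ?thesis .
qed simp

text \<open>Cyclicity of the trace carries the conjugation from \<open>X\<close> to
  \<open>Y\<close>. Being a self-adjoint involution, it is then an isometry.\<close>

lemma hs_inner_conj_by:
  assumes "X \<in> M" "Y \<in> M"
  shows "hs_inner (conj_by k X) Y = hs_inner X (conj_by k Y)"
proof -
  have "mat_trace (U k * (X * (U k * mat_adjoint Y))) = mat_trace (X * (U k * mat_adjoint Y) * U k)"
    using assms by (subst mat_trace_comm[of _ N N]) simp_all
  then show ?thesis
    using assms by (simp add: hs_inner_def conj_by_def mat_adjoint_mult[of _ N N _ N]
        assoc_mult_mat[of _ N N _ N _ N])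
qed

lemma conj_sum_add:
  assumes [simp]: "X \<in> M" "Y \<in> M"
  shows "conj_sum a k (X + Y) = conj_sum a k X + conj_sum a k Y"
proof (induct k)
  case 0
  then show ?case by (simp add: add_smult_distrib_left_mat[of _ N N])
next
  case (Suc k)
  note [simp] = carrier_matD[OF assms(2)]
  show ?case
    by (intro eq_matI) (auto simp: Suc conj_by_add)
qed

lemma conj_sum_minus:
  assumes [simp]: "X \<in> M" "Y \<in> M"
  shows "conj_sum a k (X - Y) = conj_sum a k X - conj_sum a k Y"
proof (induct k)
  case 0
  note [simp] = carrier_matD[OF assms(1)] carrier_matD[OF assms(2)]
  show ?case by (intro eq_matI) (auto simp: algebra_simps)
next
  case (Suc k)
  show ?case by (intro eq_matI) (auto simp: Suc conj_by_minus)
qed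

lemma conj_sum_smult:
  assumes [simp]: "X \<in> M"
  shows "conj_sum a k (c \<cdot>\<^sub>m X) = c \<cdot>\<^sub>m conj_sum a k X"
proof (induct k)
  case 0
  show ?case by (simp add: smult_smult_mat mult.commute)
next
  case (Suc k)
  show ?case by (intro eq_matI) (auto simp: Suc conj_by_smult algebra_simps)
qed

lemma conj_sum_shift:
  assumes [simp]: "X \<in> M"
  shows "conj_sum a k X + complex_of_real b \<cdot>\<^sub>m X = conj_sum (a + b) k X"
proof (induct k)
  case 0
  show ?case by (intro eq_matI) (auto simp: algebra_simps)
next
  case (Suc k)
  note [simp] = carrier_matD[OF assms]
  show ?case by (intro eq_matI) (auto simp flip: Suc)
qed

lemma conj_by_conj_sum:
  assumes "k \<le> m" "l < m" and [simp]: "X \<in> M"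
  shows "conj_by l (conj_sum a k X) = conj_sum a k (conj_by l X)"
  using assms(1)
proof (induct k)
  case 0
  show ?case by (simp add: conj_by_smult)
next
  case (Suc k)
  then show ?case using assms(2) by (simp add: conj_by_add conj_by_commute)
qed

lemma hs_inner_conj_sum:
  assumes [simp]: "X \<in> M" "Y \<in> M"
  shows "hs_inner (conj_sum a k X) Y = hs_inner X (conj_sum a k Y)"
  by (induct k) (simp_all add: hs_inner_simps[of _ N] hs_inner_conj_by)

lemma hs_inner_conj_sum_left:
  assumes [simp]: "X \<in> M" "Y \<in> M"
  shows "hs_inner (conj_sum 0 k X) Y = (\<Sum>j<k. hs_inner (conj_by j X) Y)"
  by (induct k) (simp_all add: hs_inner_simps[of _ N] hs_inner_smult_left[of _ N _ 0, simplified])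

lemma conj_sum_eigen:
  assumes [simp]: "X \<in> M" and "\<And>j. j < k \<Longrightarrow> conj_by j X = complex_of_real (e j) \<cdot>\<^sub>m X"
  shows "conj_sum a k X = complex_of_real (a + (\<Sum>j<k. e j)) \<cdot>\<^sub>m X"
  using assms(2)
proof (induct k)
  case (Suc k)
  then show ?case by (simp add: add_smult_distrib_right_mat[of _ N N, symmetric] add.assoc)
qed simp

section \<open>Spectral gap and Bessel inequality for the sum of conjugations\<close>

lemma parallelogram:
  assumes [simp]: "X \<in> M" "Y \<in> M"
  shows "hs_inner (X + Y) (X + Y) + hs_inner (X - Y) (X - Y) = 2 * hs_inner X X + 2 * hs_inner Y Y"
  by (simp add: hs_inner_simps[of _ N] minus_carrier_mat)

lemma hs_inner_conj_by_conj_by: "X \<in> M \<Longrightarrow> hs_inner (conj_by k X) (conj_by k X) = hs_inner X X"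
  by (simp add: hs_inner_conj_by)

text \<open>The induction splits \<open>X\<close> into the eigenvectors \<open>X \<plusminus> conj_by k X\<close> of the last involution, on which
  that involution only shifts the scalar \<open>z\<close> by one.\<close>

lemma conj_sum_gap:
  assumes "k \<le> m" "odd (z + int k)" "X \<in> M"
  shows "hs_inner X X \<le> hs_inner (conj_sum (of_int z) k X) (conj_sum (of_int z) k X)"
  using assms
proof (induct k arbitrary: z X)
  case 0
  \<comment> \<open>No involution is left, so parity makes \<open>z\<close> an odd integer and keeps
    it away from 0. The gap originates here.\<close>
  then have "1 \<le> \<bar>z\<bar>" by presburger
  then have "1 \<le> (real_of_int z)\<^sup>2"
    by (metis of_int_1_le_iff of_int_abs one_le_power power2_abs)
  then have "1 * hs_inner X X \<le> (real_of_int z)\<^sup>2 * hs_inner X X"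
    using 0 by (intro mult_right_mono hs_inner_self_nonneg)
  also have "\<dots> = hs_inner (conj_sum (of_int z) 0 X) (conj_sum (of_int z) 0 X)"
    using 0 by (simp add: hs_inner_simps[of _ N] power2_eq_square mult.assoc del: of_real_of_int_eq)
  finally show ?case by simp
next
  case (Suc k)
  note [simp] = Suc.prems(3)
  define Y where "Y = conj_sum (of_int z) (Suc k) X"
  have [simp]: "Y \<in> M" by (simp add: Y_def)
  have k: "k < m" "k \<le> m" using Suc.prems by auto
  let ?T = "conj_by k X"
  \<comment> \<open>The last involution commutes with the others and squares to the identity, so
    conjugating the last summand of \<open>Y\<close> returns \<open>X\<close>.\<close>
  have TY: "conj_by k Y = conj_sum (of_int z) k ?T + X"
    using k by (simp add: Y_def conj_by_add conj_by_conj_sum)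
  note [simp] = carrier_matD[OF Suc.prems(3)]
  have up: "conj_sum (of_int (z + 1)) k V = conj_sum (of_int z) k V + V" if "V \<in> M" for V
    using conj_sum_shift[OF that, of "of_int z" k 1] by (simp add: one_smult_mat)
  have down: "conj_sum (of_int (z - 1)) k V = conj_sum (of_int z) k V - V" if [simp]: "V \<in> M" for V
  proof -
    note [simp] = carrier_matD[OF that]
    have "conj_sum (of_int (z - 1)) k V = conj_sum (of_int z) k V + complex_of_real (- 1) \<cdot>\<^sub>m V"
      unfolding conj_sum_shift[OF that] by simp
    then show ?thesis by (intro eq_matI) auto
  qed
  \<comment> \<open>The last involution acts as 1 on \<open>X + ?T\<close> and as -1 on
    \<open>X - ?T\<close>. Shifting \<open>z\<close> by one while the number of involutions drops by
    one keeps the parity, so the induction hypothesis applies to both parts.\<close>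
  have plus: "Y + conj_by k Y = conj_sum (of_int (z + 1)) k (X + ?T)"
    unfolding TY by (subst up) (auto intro!: eq_matI simp: Y_def conj_sum_add)
  have minus: "Y - conj_by k Y = conj_sum (of_int (z - 1)) k (X - ?T)"
    unfolding TY by (subst down) (auto intro!: eq_matI simp: Y_def conj_sum_minus)
  have "4 * hs_inner X X = hs_inner (X + ?T) (X + ?T) + hs_inner (X - ?T) (X - ?T)"
    by (simp add: parallelogram hs_inner_conj_by_conj_by)
  also have "\<dots> \<le> hs_inner (Y + conj_by k Y) (Y + conj_by k Y) + hs_inner (Y - conj_by k Y) (Y - conj_by k Y)"
    unfolding plus minus using Suc.prems k by (intro add_mono Suc.hyps) auto
  also have "\<dots> = 4 * hs_inner Y Y"
    by (simp add: parallelogram hs_inner_conj_by_conj_by)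
  finally show ?case by (simp add: Y_def)
qed

text \<open>The eigenvectors are split off one at a time. Since \<Psi> is self-adjoint, the
  remainder and its image are orthogonal to the removed vector, so by Pythagoras the difference of
  the two squared norms changes by exactly the corresponding summand. The gap estimate handles the
  final remainder.\<close>

lemma conj_sum_bessel:
  assumes "odd m" "finite F" "X \<in> M"
    and e: "\<And>i. i \<in> F \<Longrightarrow> e i \<in> M"
    and eig: "\<And>i. i \<in> F \<Longrightarrow> conj_sum 0 m (e i) = complex_of_real (\<mu> i) \<cdot>\<^sub>m e i"
    and norm: "\<And>i. i \<in> F \<Longrightarrow> hs_inner (e i) (e i) = r"
    and orth: "\<And>i j. i \<in> F \<Longrightarrow> j \<in> F \<Longrightarrow> i \<noteq> j \<Longrightarrow> hs_inner (e i) (e j) = 0"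
    and "r > 0"
  shows "(\<Sum>i\<in>F. ((\<mu> i)\<^sup>2 - 1) * (hs_inner X (e i))\<^sup>2 / r)
    \<le> hs_inner (conj_sum 0 m X) (conj_sum 0 m X) - hs_inner X X"
  using assms(2,3) e eig norm orth
proof (induct F arbitrary: X)
  case empty
  then show ?case using conj_sum_gap[of m 0 X] \<open>odd m\<close> by simp
next
  case (insert i F)
  define b where "b = hs_inner X (e i) / r"
  define Y where "Y = X - complex_of_real b \<cdot>\<^sub>m e i"
  have [simp]: "X \<in> M" "e i \<in> M" using insert.prems by auto
  have [simp]: "Y \<in> M" by (simp add: Y_def)
  have eigi: "conj_sum 0 m (e i) = complex_of_real (\<mu> i) \<cdot>\<^sub>m e i" using insert.prems by auto
  have Xi: "hs_inner X (e i) = b * r" and Xi': "hs_inner (e i) X = b * r"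
    using \<open>r > 0\<close> hs_inner_commute[of X N "e i"] by (auto simp: b_def)
  have ii: "hs_inner (e i) (e i) = r" using insert.prems by auto
  have cXi: "hs_inner (conj_sum 0 m X) (e i) = \<mu> i * (b * r)"
    by (simp add: hs_inner_conj_sum eigi hs_inner_simps[of _ N] Xi)
  have cXi': "hs_inner (e i) (conj_sum 0 m X) = \<mu> i * (b * r)"
    using cXi hs_inner_commute[of "conj_sum 0 m X" N "e i"] by auto
  \<comment> \<open>By orthogonality, removing \<open>e i\<close> leaves the coefficients along the
    other eigenvectors unchanged.\<close>
  have Yj: "hs_inner Y (e j) = hs_inner X (e j)" if "j \<in> F" for j
    using insert.prems(2,5) insert.hyps that
    by (auto simp: Y_def hs_inner_simps[of _ N])
  have "(\<Sum>i\<in>F. ((\<mu> i)\<^sup>2 - 1) * (hs_inner Y (e i))\<^sup>2 / r)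
      \<le> hs_inner (conj_sum 0 m Y) (conj_sum 0 m Y) - hs_inner Y Y"
    by (rule insert.hyps(3)) (use insert.prems in auto)
  moreover have "hs_inner Y Y = hs_inner X X - b\<^sup>2 * r"
    by (simp add: Y_def hs_inner_simps[of _ N] Xi Xi' ii power2_eq_square algebra_simps)
  moreover have "hs_inner (conj_sum 0 m Y) (conj_sum 0 m Y)
      = hs_inner (conj_sum 0 m X) (conj_sum 0 m X) - (\<mu> i)\<^sup>2 * b\<^sup>2 * r"
    by (simp add: Y_def conj_sum_minus conj_sum_smult eigi hs_inner_simps[of _ N] cXi cXi' ii
        power2_eq_square algebra_simps)
  moreover have "((\<mu> i)\<^sup>2 - 1) * (hs_inner X (e i))\<^sup>2 / r = (\<mu> i)\<^sup>2 * b\<^sup>2 * r - b\<^sup>2 * r"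
    using \<open>r > 0\<close> by (simp add: Xi power2_eq_square field_simps)
  ultimately show ?case using insert.hyps Yj by simp
qed

section \<open>Products of two generators as eigenvectors\<close>

text \<open>The factor \<open>\<i>\<close> makes the product of two different generators self-adjoint; the pair \<open>(0, 0)\<close>
  stands for the identity.\<close>

definition herm_pair :: "nat \<times> nat \<Rightarrow> complex mat" where
  "herm_pair = (\<lambda>(k, l). (if k = l then 1 else \<i>) \<cdot>\<^sub>m (U k * U l))"

text \<open>The eigenvalue of conjugation by \<open>U j\<close> at the eigenvector
  \<open>U k\<close>.\<close>

abbreviation sgn_eig :: "nat \<Rightarrow> nat \<Rightarrow> real" where
  "sgn_eig j k \<equiv> (if j = k then 1 else - 1)"

lemma herm_pair_carrier [simp]: "herm_pair p \<in> M"
  by (simp add: herm_pair_def split: prod.split)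

lemma conj_by_U:
  assumes "j < m" "k < m"
  shows "conj_by j (U k) = complex_of_real (sgn_eig j k) \<cdot>\<^sub>m U k"
proof (cases "j = k")
  case True
  then show ?thesis by (simp add: conj_by_def one_smult_mat left_mult_one_mat[of _ N N])
next
  case False
  have "conj_by j (U k) = (- 1 \<cdot>\<^sub>m (U k * U j)) * U j"
    using U_anticommute[OF assms False] by (simp add: conj_by_def)
  also have "\<dots> = - 1 \<cdot>\<^sub>m U k"
    by (simp add: right_mult_one_mat[of _ N N] mult_smult_assoc_mat[of _ N N _ N] assoc_mult_mat[of _ N N _ N _ N])
  finally show ?thesis using False by simp
qed

lemma conj_by_mult:
  assumes [simp]: "A \<in> M" "B \<in> M"
  shows "conj_by j (A * B) = conj_by j A * conj_by j B"
  by (simp add: conj_by_def assoc_mult_mat[of _ N N _ N _ N] U_cancel)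

lemma conj_by_herm_pair:
  assumes "j < m" "k < m" "l < m"
  shows "conj_by j (herm_pair (k, l)) = complex_of_real (sgn_eig j k * sgn_eig j l) \<cdot>\<^sub>m herm_pair (k, l)"
  using assms
  by (simp add: herm_pair_def conj_by_smult conj_by_mult conj_by_U mult_smult_distrib[of _ N N _ N]
      mult_smult_assoc_mat[of _ N N _ N] smult_smult_mat one_smult_mat mult.commute)

lemma hs_inner_eigen_orthogonal:
  assumes "X \<in> M" "Y \<in> M"
    and "conj_by j X = complex_of_real a \<cdot>\<^sub>m X" "conj_by j Y = complex_of_real b \<cdot>\<^sub>m Y" "a \<noteq> b"
  shows "hs_inner X Y = 0"
  using hs_inner_conj_by[of X Y j] assms by (simp add: hs_inner_simps[of _ N])

text \<open>All these operators are simultaneous eigenvectors of the conjugations. For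
  \<open>k < l\<close> the sign is -1 exactly at \<open>j = k\<close> and \<open>j = l\<close>,
  while for \<open>(0, 0)\<close> it is 1 throughout, so different pairs have different sign
  patterns and some index separates them.\<close>

lemma herm_pair_orthogonal:
  assumes "k < l \<and> l < m \<or> k = 0 \<and> l = 0 \<and> 0 < m" "k' < l' \<and> l' < m \<or> k' = 0 \<and> l' = 0 \<and> 0 < m"
    and "(k, l) \<noteq> (k', l')"
  shows "hs_inner (herm_pair (k, l)) (herm_pair (k', l')) = 0"
proof -
  have "\<exists>j\<in>{k, l, k', l'}. sgn_eig j k * sgn_eig j l \<noteq> sgn_eig j k' * sgn_eig j l'"
    using assms by (cases "k < l"; cases "k' < l'") auto
  then obtain j where j: "j \<in> {k, l, k', l'}"
    and "sgn_eig j k * sgn_eig j l \<noteq> sgn_eig j k' * sgn_eig j l'" by blast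
  moreover have "k < m" "l < m" "k' < m" "l' < m" using assms by auto
  moreover from j this have "j < m" by (elim insertE emptyE) simp_all
  ultimately show ?thesis
    using hs_inner_eigen_orthogonal[OF _ _ conj_by_herm_pair conj_by_herm_pair] by simp
qed

lemma herm_pair_norm: "hs_inner (herm_pair p) (herm_pair p) = N"
  by (cases p) (simp add: herm_pair_def hs_inner_def mat_adjoint_smult mat_adjoint_mult[of _ N N _ N]
    mult_smult_distrib[of _ N N _ N] mult_smult_assoc_mat[of _ N N _ N] smult_smult_mat
    one_smult_mat assoc_mult_mat[of _ N N _ N _ N] U_cancel mat_trace_one)

lemma herm_pair_adjoint:
  assumes "k < m" "l < m"
  shows "mat_adjoint (herm_pair (k, l)) = herm_pair (k, l)"
  using assms U_anticommute[of l k]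
  by (cases "k = l") (simp_all add: herm_pair_def mat_adjoint_smult mat_adjoint_mult[of _ N N _ N]
    smult_smult_mat one_smult_mat mat_adjoint_one)

text \<open>Exactly two of the \<open>m\<close> signs equal -1, whence
  \<open>(m - 2) - 2\<close>.\<close>

lemma conj_sum_herm_pair_offdiag:
  assumes "k < l" "l < m"
  shows "conj_sum 0 m (herm_pair (k, l)) = complex_of_real (real m - 4) \<cdot>\<^sub>m herm_pair (k, l)"
proof -
  have "sgn_eig j k * sgn_eig j l = 1 - 2 * of_bool (j = k) - 2 * of_bool (j = l)" for j
    using assms by auto
  then have "(\<Sum>j<m. sgn_eig j k * sgn_eig j l)
      = (\<Sum>j<m. 1 - 2 * of_bool (j = k) - 2 * of_bool (j = l))"
    by (intro sum.cong) auto
  also have "\<dots> = real m - 4"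
  proof -
    have "(\<Sum>j<m. of_bool (j = i)) = (1 :: real)" if "i < m" for i
      using that by (simp add: of_bool_def)
    then show ?thesis using assms by (simp add: sum_subtractf flip: sum_distrib_left)
  qed
  finally show ?thesis
    using conj_sum_eigen[OF herm_pair_carrier conj_by_herm_pair[of _ k l], of m 0] assms by simp
qed

lemma conj_sum_herm_pair_diag:
  assumes "k < m"
  shows "conj_sum 0 m (herm_pair (k, k)) = complex_of_real (real m) \<cdot>\<^sub>m herm_pair (k, k)"
proof -
  have "(\<Sum>j<m. sgn_eig j k * sgn_eig j k) = (\<Sum>j<m. 1)"
    by (intro sum.cong) auto
  then show ?thesis
    using conj_sum_eigen[OF herm_pair_carrier conj_by_herm_pair[of _ k k], of m 0] assms by simp
qed

section \<open>Detection conditions and the trace inequality\<close>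

text \<open>Write \<open>W\<close> for the self-adjoint pair. Moving both conjugations to one side
  turns the left-hand side into the trace of \<open>P * W * P * W\<close>, and detection replaces
  \<open>P * W * P\<close> by a multiple \<open>w\<close> of \<open>P\<close>. As the trace of
  \<open>P * W\<close> is \<open>w\<close> times that of \<open>P\<close>, eliminating
  \<open>w\<close> gives the quotient.\<close>

lemma hs_inner_conj_projection:
  assumes P [simp]: "P \<in> M" and idem: "P * P = P" and adj: "mat_adjoint P = P"
    and D: "hs_inner P P > 0" and kl: "k < l" "l < m"
    and det: "P * (U k * U l) * P = c \<cdot>\<^sub>m P"
  shows "hs_inner (conj_by k P) (conj_by l P) = (hs_inner P (herm_pair (k, l)))\<^sup>2 / hs_inner P P"
proof -
  let ?herm_pair = "herm_pair (k, l)" and ?D = "hs_inner P P"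
  define w where "w = \<i> * c"
  have Wadj: "mat_adjoint ?herm_pair = ?herm_pair" using herm_pair_adjoint kl by simp
  have PWP: "P * ?herm_pair * P = w \<cdot>\<^sub>m P"
    using kl det by (simp add: herm_pair_def w_def mult_smult_distrib[of _ N N _ N]
      mult_smult_assoc_mat[of _ N N _ N] smult_smult_mat del: assoc_mult_mat)
  have trP: "Re (mat_trace P) = ?D" by (simp add: hs_inner_def adj idem)
  have trP_real: "Im (mat_trace P) = 0"
  proof -
    have "cnj (P $$ (i, i)) = P $$ (i, i)" if "i < N" for i
      using that carrier_matD[OF P] mat_adjoint_index[of i P i] by (simp add: adj)
    then have "Im (P $$ (i, i)) = 0" if "i < N" for i
      using that by (metis complex_cnj_cancel_iff Reals_cnj_iff complex_is_Real_iff)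
    then show ?thesis using carrier_matD[OF P] by (simp add: mat_trace_def)
  qed
  have trPe: "mat_trace P = complex_of_real ?D"
    using trP trP_real by (simp add: complex_eq_iff)
  have "mat_trace (P * ?herm_pair) = mat_trace (P * ?herm_pair * P)"
    by (subst mat_trace_comm[of "P * ?herm_pair" N N P])
       (simp_all add: idem flip: assoc_mult_mat[of _ N N _ N _ N])
  then have trPW: "mat_trace (P * ?herm_pair) = w * complex_of_real ?D"
    by (simp add: PWP mat_trace_smult[of _ N] trPe)
  \<comment> \<open>The scalar \<open>w\<close> is real: \<open>P * ?herm_pair * P\<close> is
    self-adjoint and \<open>P\<close> has non-zero trace.\<close>
  have "cnj w \<cdot>\<^sub>m P = mat_adjoint (P * ?herm_pair * P)"
    by (simp add: PWP mat_adjoint_smult adj)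
  also have "\<dots> = P * ?herm_pair * P"
    by (simp add: mat_adjoint_mult[of _ N N _ N] adj Wadj assoc_mult_mat[of _ N N _ N _ N])
  finally have "mat_trace (cnj w \<cdot>\<^sub>m P) = mat_trace (w \<cdot>\<^sub>m P)" by (simp add: PWP)
  then have "cnj w = w" using D by (simp add: mat_trace_smult[of _ N] trPe)
  then have "Im w = 0" by (metis Reals_cnj_iff complex_is_Real_iff)
  have t: "hs_inner P ?herm_pair = Re w * ?D"
    by (simp add: hs_inner_def[of _ ?herm_pair] Wadj trPW)
  have UlUk: "U l * U k = - 1 \<cdot>\<^sub>m (U k * U l)"
    by (rule U_anticommute) (use kl in auto)
  \<comment> \<open>Reversing the second product produces a sign, which the two factors \<i> inside
    \<open>?herm_pair\<close> absorb.\<close>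
  have "conj_by k (conj_by l P) = (U k * U l) * P * (U l * U k)"
    by (simp add: conj_by_def assoc_mult_mat[of _ N N _ N _ N])
  also have "\<dots> = ?herm_pair * P * ?herm_pair"
    using kl by (simp add: UlUk herm_pair_def mult_smult_distrib[of _ N N _ N]
      mult_smult_assoc_mat[of _ N N _ N] smult_smult_mat del: assoc_mult_mat)
  finally have "hs_inner (conj_by k P) (conj_by l P) = hs_inner P (?herm_pair * P * ?herm_pair)"
    by (simp add: hs_inner_conj_by)
  also have "\<dots> = Re (mat_trace (P * ?herm_pair * P * ?herm_pair))"
    by (simp add: hs_inner_def mat_adjoint_mult[of _ N N _ N] adj Wadj assoc_mult_mat[of _ N N _ N _ N])
  also have "\<dots> = Re (w * (w * ?D))"
    by (simp add: PWP mult_smult_assoc_mat[of _ N N _ N] mat_trace_smult[of _ N] trPW del: assoc_mult_mat)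
  also have "\<dots> = (hs_inner P ?herm_pair)\<^sup>2 / ?D"
    using \<open>Im w = 0\<close> D by (simp add: t power2_eq_square)
  finally show ?thesis .
qed

text \<open>The witness \<open>s\<close> is the sum of \<open>\<bar>c\<bar>\<^sup>2\<close> over the pairs \<open>k < l\<close>, where \<open>P * (U k * U l) * P = c \<cdot>\<^sub>m P\<close>.\<close>

lemma projection_trace_inequality:
  assumes P [simp]: "P \<in> M" and idem: "P * P = P" and adj: "mat_adjoint P = P"
    and D: "hs_inner P P > 0" and m: "odd m" and N: "0 < N"
    and det: "\<And>k l. k < l \<Longrightarrow> l < m \<Longrightarrow> \<exists>c. P * (U k * U l) * P = c \<cdot>\<^sub>m P"
  obtains s where "s \<ge> 0"
    "((real m)\<^sup>2 - 1) * hs_inner P P / N + ((real m - 4)\<^sup>2 - 1) * hs_inner P P * s / N \<le> real m - 1 + 2 * s"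
proof -
  let ?L = "{(k, l). k < l \<and> l < m}" and ?D = "hs_inner P P"
  have fin: "finite ?L"
    by (rule finite_subset[of _ "{..<m} \<times> {..<m}"]) auto
  have "0 < m" using m by (cases m) auto
  define t where "t p = hs_inner P (herm_pair p)" for p
  define s where "s = (\<Sum>p\<in>?L. (t p)\<^sup>2) / ?D\<^sup>2"
  define \<mu> where "\<mu> p = (if p = (0, 0) then real m else real m - 4)" for p :: "nat \<times> nat"
  have G: "hs_inner (conj_by k P) (conj_by l P) = (t (k, l))\<^sup>2 / ?D" if "k < l" "l < m" for k l
    using det[OF that] hs_inner_conj_projection[OF P idem adj D that] by (auto simp: t_def)
  \<comment> \<open>\<open>herm_pair (0, 0)\<close> is the identity, so this component is the trace
    of \<open>P\<close>, that is \<open>?D\<close>.\<close>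
  have t0: "t (0, 0) = ?D"
    by (simp add: t_def herm_pair_def hs_inner_def one_smult_mat mat_adjoint_one adj idem right_mult_one_mat[of _ N N])
  \<comment> \<open>Exact evaluation of the squared norm: the diagonal Gram entries are
    \<open>?D\<close> by isometry, the others are given by \<open>G\<close>.\<close>
  have "hs_inner (conj_sum 0 m P) (conj_sum 0 m P) = (\<Sum>k<m. \<Sum>l<m. hs_inner (conj_by k P) (conj_by l P))"
    by (simp add: hs_inner_conj_sum_left hs_inner_commute[of "conj_by k P" N "conj_sum 0 m P" for k]
        hs_inner_commute[of "conj_by k P" N "conj_by l P" for k l])
  also have "\<dots> = real m * ?D + 2 * (\<Sum>(k, l)\<in>?L. hs_inner (conj_by k P) (conj_by l P))"
    by (subst sum_square_symmetric) (auto simp: hs_inner_conj_by_conj_by intro: hs_inner_commute[of _ N])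
  also have "(\<Sum>(k, l)\<in>?L. hs_inner (conj_by k P) (conj_by l P)) = (\<Sum>p\<in>?L. (t p)\<^sup>2 / ?D)"
    by (intro sum.cong) (auto simp: G)
  also have "\<dots> = s * ?D"
    using D by (simp add: s_def sum_divide_distrib[symmetric] power2_eq_square)
  finally have norm: "hs_inner (conj_sum 0 m P) (conj_sum 0 m P) = real m * ?D + 2 * (s * ?D)" .
  \<comment> \<open>The Bessel estimate bounds the same norm from below through the identity
    component and all pair components.\<close>
  have "(\<Sum>p\<in>insert (0, 0) ?L. ((\<mu> p)\<^sup>2 - 1) * (hs_inner P (herm_pair p))\<^sup>2 / N)
      \<le> hs_inner (conj_sum 0 m P) (conj_sum 0 m P) - ?D"
  proof (rule conj_sum_bessel[OF m])
    fix p assume "p \<in> insert (0, 0) ?L"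
    then show "conj_sum 0 m (herm_pair p) = complex_of_real (\<mu> p) \<cdot>\<^sub>m herm_pair p"
      using \<open>0 < m\<close> by (auto simp: \<mu>_def conj_sum_herm_pair_diag conj_sum_herm_pair_offdiag)
  next
    fix p q assume "p \<in> insert (0, 0) ?L" "q \<in> insert (0, 0) ?L" "p \<noteq> q"
    then show "hs_inner (herm_pair p) (herm_pair q) = 0"
      using \<open>0 < m\<close> by (cases p; cases q) (auto intro!: herm_pair_orthogonal)
  qed (use fin N in \<open>auto simp: herm_pair_norm\<close>)
  also have "(\<Sum>p\<in>insert (0, 0) ?L. ((\<mu> p)\<^sup>2 - 1) * (hs_inner P (herm_pair p))\<^sup>2 / N)
      = ((real m)\<^sup>2 - 1) * ?D\<^sup>2 / N + (\<Sum>p\<in>?L. ((real m - 4)\<^sup>2 - 1) * (t p)\<^sup>2 / N)"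
    using fin by (subst sum.insert) (auto simp: \<mu>_def t0[unfolded t_def] t_def intro!: sum.cong)
  also have "(\<Sum>p\<in>?L. ((real m - 4)\<^sup>2 - 1) * (t p)\<^sup>2 / N) = ((real m - 4)\<^sup>2 - 1) * (s * ?D\<^sup>2) / N"
    using D by (simp add: s_def sum_divide_distrib[symmetric] sum_distrib_left[symmetric])
  finally have "?D * (((real m)\<^sup>2 - 1) * ?D / N + ((real m - 4)\<^sup>2 - 1) * ?D * s / N)
      \<le> ?D * (real m - 1 + 2 * s)"
    unfolding norm by (simp add: power2_eq_square algebra_simps)
  then have "((real m)\<^sup>2 - 1) * ?D / N + ((real m - 4)\<^sup>2 - 1) * ?D * s / N \<le> real m - 1 + 2 * s"
    using D by simp
  moreover have "s \<ge> 0" by (simp add: s_def sum_nonneg)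
  ultimately show ?thesis using that by blast
qed

end

section \<open>Arithmetic of the bound\<close>

text \<open>The terms in \<open>s\<close> can be dropped because \<open>(n - 1) * (n - 2) \<ge> n + 1\<close>; this fails for \<open>n = 3\<close>, where
  \<open>D \<ge> 2\<close> takes its place.\<close>

lemma dimension_bound_arith:
  assumes "n \<ge> 3" and "s \<ge> 0" and "n = 3 \<longrightarrow> D \<ge> 2"
    and "((real (2 * n + 1))\<^sup>2 - 1) * D / 2 ^ n + ((real (2 * n + 1) - 4)\<^sup>2 - 1) * D * s / 2 ^ n
      \<le> real (2 * n + 1) - 1 + 2 * s"
  shows "D \<le> 2 ^ (n - 1) / (real n + 1)"
proof (rule ccontr)
  assume "\<not> ?thesis"
  define x where "x = D / 2 ^ n"
  have "(2::real) ^ n = 2 * 2 ^ (n - 1)" using assms(1) by (cases n) auto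
  with \<open>\<not> ?thesis\<close> have x: "x * (2 * (real n + 1)) > 1"
    by (simp add: x_def field_simps)
  define y where "y = real n"
  have "y \<ge> 3" using assms(1) by (simp add: y_def)
  \<comment> \<open>Both coefficients factor, \<open>(2n + 1)^2 - 1 = 4n(n + 1)\<close> and
    \<open>(2n - 3)^2 - 1 = 4(n - 1)(n - 2)\<close>, and the inequality is then halved.\<close>
  have ineq: "2 * y * (y + 1) * x + 2 * (y - 1) * (y - 2) * x * s \<le> y + s"
    using assms(4) by (simp add: x_def y_def power2_eq_square field_simps)
  \<comment> \<open>If the bound fails, the first term alone exceeds \<open>y\<close>. Once the
    coefficient of \<open>s\<close> on the left is at least 1, \<open>ineq\<close> is
    impossible.\<close>
  have 1: "y * (x * (2 * (y + 1))) > y * 1"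
    using x \<open>y \<ge> 3\<close> by (intro mult_strict_left_mono) (auto simp: y_def)
  have 2: "2 * (y - 1) * (y - 2) * x \<ge> 1"
  proof (cases "n = 3")
    \<comment> \<open>Here the coefficient equals \<open>D / 2\<close>.\<close>
    case True
    then show ?thesis using assms(3) by (simp add: x_def y_def)
  next
    case False
    then have "y \<ge> 4" using assms(1) by (simp add: y_def)
    then have "0 \<le> (y - 4) * y" by simp
    then have "y + 1 \<le> (y - 1) * (y - 2)" by (simp add: algebra_simps)
    moreover have "x \<ge> 0" using x by (smt (verit) mult_nonpos_nonneg of_nat_0_le_iff)
    ultimately have "(y + 1) * (2 * x) \<le> (y - 1) * (y - 2) * (2 * x)" by (intro mult_right_mono) auto
    then show ?thesis using x by (simp add: y_def algebra_simps)
  qed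
  have "1 * s \<le> 2 * (y - 1) * (y - 2) * x * s"
    using 2 assms(2) by (intro mult_right_mono)
  with 1 ineq show False by (simp add: algebra_simps)
qed

subsection \<open>Kronecker products and the spinorial generators\<close>

lemma sum_lessThan_mult:
  "(\<Sum>k<b * d. f (k div d) (k mod d)) = (\<Sum>x<b. \<Sum>y<(d::nat). f x y)"
proof -
  have "(\<Sum>k\<in>{x * d..<x * d + d}. f (k div d) (k mod d)) = (\<Sum>y<d. f x y)" for x
  proof -
    have "(\<Sum>k\<in>{x * d..<x * d + d}. f (k div d) (k mod d))
        = (\<Sum>y<d. f ((x * d + y) div d) ((x * d + y) mod d))"
      by (rule sum.reindex_bij_witness[of _ "\<lambda>y. x * d + y" "\<lambda>k. k - x * d"]) auto
    then show ?thesis by simp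
  qed
  then have "(\<Sum>x<b. \<Sum>k\<in>{x * d..<x * d + d}. f (k div d) (k mod d)) = (\<Sum>x<b. \<Sum>y<d. f x y)"
    by simp
  then show ?thesis by (simp add: sum.nat_group)
qed

lemma kron_carrier [simp]:
  "A \<in> carrier_mat a b \<Longrightarrow> B \<in> carrier_mat c d \<Longrightarrow> kron A B \<in> carrier_mat (a * c) (b * d)"
  by (auto simp: kron_def)

text \<open>The mixed-product rule. The summation index splits into quotient and remainder by
  \<open>d\<close>, and the double sum factors.\<close>

lemma kron_mult:
  assumes A: "A \<in> carrier_mat a b" and B: "B \<in> carrier_mat c d"
    and A': "A' \<in> carrier_mat b e" and B': "B' \<in> carrier_mat d f"
  shows "kron A B * kron A' B' = kron (A * A') (B * B')"
proof (rule eq_matI)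
  note [simp] = carrier_matD[OF A] carrier_matD[OF B] carrier_matD[OF A'] carrier_matD[OF B']
  fix i j assume "i < dim_row (kron (A * A') (B * B'))" "j < dim_col (kron (A * A') (B * B'))"
  then have ij: "i < a * c" "j < e * f" by (auto simp: kron_def)
  then have ij': "i div c < a" "i mod c < c" "j div f < e" "j mod f < f"
    by (auto simp: less_mult_imp_div_less intro!: mod_less_divisor gr0I)
  have "(kron A B * kron A' B') $$ (i, j)
      = (\<Sum>k<b * d. (A $$ (i div c, k div d) * B $$ (i mod c, k mod d))
          * (A' $$ (k div d, j div f) * B' $$ (k mod d, j mod f)))"
    using ij by (auto simp: kron_def scalar_prod_def lessThan_atLeast0 intro!: sum.cong)
  also have "\<dots> = (\<Sum>x<b. \<Sum>y<d. (A $$ (i div c, x) * B $$ (i mod c, y)) * (A' $$ (x, j div f) * B' $$ (y, j mod f)))"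
    by (rule sum_lessThan_mult)
  also have "\<dots> = (\<Sum>x<b. A $$ (i div c, x) * A' $$ (x, j div f)) * (\<Sum>y<d. B $$ (i mod c, y) * B' $$ (y, j mod f))"
    by (simp add: sum_product mult.commute mult.left_commute)
  also have "\<dots> = kron (A * A') (B * B') $$ (i, j)"
    using ij ij' by (auto simp: kron_def scalar_prod_def lessThan_atLeast0)
  finally show "(kron A B * kron A' B') $$ (i, j) = kron (A * A') (B * B') $$ (i, j)" .
qed (use assms in \<open>auto simp: kron_def\<close>)

lemma kron_smult: "kron (a \<cdot>\<^sub>m A) (b \<cdot>\<^sub>m B) = (a * b) \<cdot>\<^sub>m kron A B"
proof (rule eq_matI)
  fix i j assume "i < dim_row ((a * b) \<cdot>\<^sub>m kron A B)" "j < dim_col ((a * b) \<cdot>\<^sub>m kron A B)"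
  then have ij: "i < dim_row A * dim_row B" "j < dim_col A * dim_col B" by (auto simp: kron_def)
  then have "i div dim_row B < dim_row A" "i mod dim_row B < dim_row B"
      "j div dim_col B < dim_col A" "j mod dim_col B < dim_col B"
    by (auto simp: less_mult_imp_div_less intro!: mod_less_divisor gr0I)
  then show "kron (a \<cdot>\<^sub>m A) (b \<cdot>\<^sub>m B) $$ (i, j) = ((a * b) \<cdot>\<^sub>m kron A B) $$ (i, j)"
    using ij by (simp add: kron_def)
qed (auto simp: kron_def)

lemma kron_adjoint: "mat_adjoint (kron A B) = kron (mat_adjoint A) (mat_adjoint B)"
proof (rule eq_matI)
  fix i j assume "i < dim_row (kron (mat_adjoint A) (mat_adjoint B))"
    "j < dim_col (kron (mat_adjoint A) (mat_adjoint B))"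
  then have ij: "i < dim_col A * dim_col B" "j < dim_row A * dim_row B" by (auto simp: kron_def)
  then have "i div dim_col B < dim_col A" "i mod dim_col B < dim_col B"
      "j div dim_row B < dim_row A" "j mod dim_row B < dim_row B"
    by (auto simp: less_mult_imp_div_less intro!: mod_less_divisor gr0I)
  then show "mat_adjoint (kron A B) $$ (i, j) = kron (mat_adjoint A) (mat_adjoint B) $$ (i, j)"
    using ij by (simp add: kron_def)
qed (auto simp: kron_def)

lemma kron_one: "kron (1\<^sub>m a) (1\<^sub>m b) = 1\<^sub>m (a * b)"
proof (rule eq_matI)
  fix i j assume "i < dim_row (1\<^sub>m (a * b) :: complex mat)" "j < dim_col (1\<^sub>m (a * b) :: complex mat)"
  then have ij: "i < a * b" "j < a * b" by auto
  then have "i div b < a" "i mod b < b" "j div b < a" "j mod b < b"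
    by (auto simp: less_mult_imp_div_less intro!: mod_less_divisor gr0I)
  moreover have "i div b = j div b \<and> i mod b = j mod b \<longleftrightarrow> i = j"
    by (metis div_mult_mod_eq)
  ultimately show "kron (1\<^sub>m a) (1\<^sub>m b) $$ (i, j) = 1\<^sub>m (a * b) $$ (i, j)"
    using ij by (auto simp: kron_def)
qed (auto simp: kron_def)

lemma kron_list_simps [simp]:
  "kron_list [] = 1\<^sub>m 1" "kron_list (A # As) = kron A (kron_list As)"
  by (simp_all add: kron_list_def)

lemma kron_list_carrier:
  "set As \<subseteq> carrier_mat 2 2 \<Longrightarrow> kron_list As \<in> carrier_mat (2 ^ length As) (2 ^ length As)"
  by (induct As) auto

text \<open>By the mixed-product rule the scalars of the sites multiply, so anticommutation of
  strings becomes a matter of counting the sites where the letters anticommute.\<close>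

lemma kron_list_commutation:
  assumes "length As = length Bs" "set As \<subseteq> carrier_mat 2 2" "set Bs \<subseteq> carrier_mat 2 2"
    and "\<And>i. i < length As \<Longrightarrow> As ! i * Bs ! i = s i \<cdot>\<^sub>m (Bs ! i * As ! i)"
  shows "kron_list As * kron_list Bs = (\<Prod>i<length As. s i) \<cdot>\<^sub>m (kron_list Bs * kron_list As)"
  using assms
proof (induct As Bs arbitrary: s rule: list_induct2)
  case Nil
  show ?case by (simp add: one_smult_mat)
next
  case (Cons A As B Bs)
  let ?k = "2 ^ length As :: nat"
  have c [simp]: "A \<in> carrier_mat 2 2" "B \<in> carrier_mat 2 2"
      "kron_list As \<in> carrier_mat ?k ?k" "kron_list Bs \<in> carrier_mat ?k ?k"
    using Cons.prems kron_list_carrier[of As] kron_list_carrier[of Bs] Cons.hyps(1) by auto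
  have "A * B = s 0 \<cdot>\<^sub>m (B * A)" using Cons.prems(3)[of 0] by simp
  moreover have "kron_list As * kron_list Bs = (\<Prod>i<length As. s (Suc i)) \<cdot>\<^sub>m (kron_list Bs * kron_list As)"
    using Cons.prems by (intro Cons.hyps(2)) force+
  ultimately show ?case
    by (simp add: kron_mult[OF c(1,3,2,4)] kron_mult[OF c(2,4,1,3)] kron_smult prod.lessThan_Suc_shift
        del: prod.lessThan_Suc)
qed

lemma kron_list_square:
  assumes "\<And>A. A \<in> set As \<Longrightarrow> A \<in> carrier_mat 2 2 \<and> A * A = 1\<^sub>m 2"
  shows "kron_list As * kron_list As = 1\<^sub>m (2 ^ length As)"
  using assms
proof (induct As)
  case (Cons A As)
  have c: "A \<in> carrier_mat 2 2" "kron_list As \<in> carrier_mat (2 ^ length As) (2 ^ length As)"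
    using Cons.prems kron_list_carrier[of As] by auto
  then show ?case using Cons by (simp add: kron_mult[OF c c] kron_one)
qed simp

lemma kron_list_adjoint:
  assumes "\<And>A. A \<in> set As \<Longrightarrow> mat_adjoint A = A"
  shows "mat_adjoint (kron_list As) = kron_list As"
  using assms by (induct As) (simp_all add: kron_adjoint mat_adjoint_one)

section \<open>Pauli matrices and Jordan-Wigner strings\<close>

lemma sigma_carrier [simp]:
  "sigma_x \<in> carrier_mat 2 2" "sigma_y \<in> carrier_mat 2 2" "sigma_z \<in> carrier_mat 2 2"
  by (simp_all add: sigma_x_def sigma_y_def sigma_z_def mat_of_rows_list_def numeral_2_eq_2)

lemma sigma_dim [simp]:
  "dim_row sigma_x = 2" "dim_row sigma_y = 2" "dim_row sigma_z = 2"
  "dim_col sigma_x = 2" "dim_col sigma_y = 2" "dim_col sigma_z = 2"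
  using sigma_carrier by blast+

lemma sigma_index [simp]:
  "i < 2 \<Longrightarrow> j < 2 \<Longrightarrow> sigma_x $$ (i, j) = (if i = j then 0 else 1)"
  "i < 2 \<Longrightarrow> j < 2 \<Longrightarrow> sigma_y $$ (i, j) = (if i = j then 0 else if i = 0 then - \<i> else \<i>)"
  "i < 2 \<Longrightarrow> j < 2 \<Longrightarrow> sigma_z $$ (i, j) = (if i = j then if i = 0 then 1 else - 1 else 0)"
  by (auto simp: sigma_x_def sigma_y_def sigma_z_def mat_of_rows_list_def less_2_cases_iff)

lemma sigma_adjoint:
  "mat_adjoint sigma_x = sigma_x" "mat_adjoint sigma_y = sigma_y" "mat_adjoint sigma_z = sigma_z"
  by (auto intro!: eq_matI)

lemma sigma_square:
  "sigma_x * sigma_x = 1\<^sub>m 2" "sigma_y * sigma_y = 1\<^sub>m 2" "sigma_z * sigma_z = 1\<^sub>m 2"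
  by (auto intro!: eq_matI simp: scalar_prod_def numeral_2_eq_2 sum.atLeast0_lessThan_Suc less_Suc_eq)

lemma sigma_anticommute:
  "sigma_x * sigma_y = - 1 \<cdot>\<^sub>m (sigma_y * sigma_x)"
  "sigma_y * sigma_x = - 1 \<cdot>\<^sub>m (sigma_x * sigma_y)"
  "sigma_x * sigma_z = - 1 \<cdot>\<^sub>m (sigma_z * sigma_x)"
  "sigma_z * sigma_x = - 1 \<cdot>\<^sub>m (sigma_x * sigma_z)"
  "sigma_y * sigma_z = - 1 \<cdot>\<^sub>m (sigma_z * sigma_y)"
  "sigma_z * sigma_y = - 1 \<cdot>\<^sub>m (sigma_y * sigma_z)"
  by (auto intro!: eq_matI simp: scalar_prod_def numeral_2_eq_2 sum.atLeast0_lessThan_Suc less_Suc_eq)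

text \<open>For \<open>p = n\<close> the letter \<open>A\<close> does not occur, and the string is the last generator.\<close>

definition jw_string :: "nat \<Rightarrow> nat \<Rightarrow> complex mat \<Rightarrow> complex mat list" where
  "jw_string n p A = map (\<lambda>i. if i < p then sigma_z else if i = p then A else 1\<^sub>m 2) [0..<n]"

text \<open>Brings the three families of generators to one shape with 0-based positions, so that two
  generators can be compared by position and letter alone.\<close>

lemma spin_gen_eq_jw_string:
  "spin_gen n (Suc k) = kron_list (jw_string n (if k < n then k else if k < 2 * n then k - n else n)
     (if k < n then sigma_x else sigma_y))"
proof -
  have str: "replicate p sigma_z @ [A] @ replicate (n - Suc p) (1\<^sub>m 2) = jw_string n p A" if "p < n" for p A
    using that by (intro nth_equalityI) (auto simp: jw_string_def nth_append nth_Cons split: nat.split)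
  have str_n: "replicate n sigma_z = jw_string n n A" for A
    by (intro nth_equalityI) (auto simp: jw_string_def)
  consider "k < n" | "n \<le> k" "k < 2 * n" | "2 * n \<le> k" by linarith
  then show ?thesis
  proof cases
    case 1
    then show ?thesis using str[of k sigma_x] by (simp add: spin_gen_def)
  next
    case 2
    then have "spin_gen n (Suc k)
        = kron_list (replicate (k - n) sigma_z @ [sigma_y] @ replicate (n - Suc (k - n)) (1\<^sub>m 2))"
      by (simp add: spin_gen_def)
    also have "\<dots> = kron_list (jw_string n (k - n) sigma_y)"
      using 2 by (subst str) auto
    finally show ?thesis using 2 by simp
  next
    case 3
    then show ?thesis using str_n[of sigma_y] by (simp add: spin_gen_def)
  qed
qed

text \<open>Only the site \<open>min p q\<close> contributes a sign: before it both letters are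
  \<open>sigma_z\<close>, after it one of them is the identity, and at it the two letters
  anticommute.\<close>

lemma jw_string_anticommute:
  assumes c: "A \<in> carrier_mat 2 2" "B \<in> carrier_mat 2 2" and pq: "min p q < n"
    and A: "A * sigma_z = - 1 \<cdot>\<^sub>m (sigma_z * A)" and B: "sigma_z * B = - 1 \<cdot>\<^sub>m (B * sigma_z)"
    and AB: "p = q \<Longrightarrow> A * B = - 1 \<cdot>\<^sub>m (B * A)"
  shows "kron_list (jw_string n p A) * kron_list (jw_string n q B)
    = - 1 \<cdot>\<^sub>m (kron_list (jw_string n q B) * kron_list (jw_string n p A))"
proof -
  let ?s = "\<lambda>i. if i = min p q then - 1 else (1 :: complex)"
  have "jw_string n p A ! i * jw_string n q B ! i = ?s i \<cdot>\<^sub>m (jw_string n q B ! i * jw_string n p A ! i)"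
    if "i < n" for i
    using that A B AB c
    by (cases i p rule: linorder_cases; cases i q rule: linorder_cases)
      (auto simp: jw_string_def one_smult_mat left_mult_one_mat[of _ 2 2] right_mult_one_mat[of _ 2 2])
  then have "kron_list (jw_string n p A) * kron_list (jw_string n q B)
      = (\<Prod>i<length (jw_string n p A). ?s i) \<cdot>\<^sub>m (kron_list (jw_string n q B) * kron_list (jw_string n p A))"
    using c by (intro kron_list_commutation) (auto simp: jw_string_def)
  also have "(\<Prod>i<length (jw_string n p A). ?s i) = - 1"
    using pq by (simp add: jw_string_def prod.delta)
  finally show ?thesis .
qed

lemma spin_gen_clifford: "clifford_family (2 ^ n) (2 * n + 1) (\<lambda>k. spin_gen n (Suc k))"
proof
  fix k
  let ?js = "jw_string n (if k < n then k else if k < 2 * n then k - n else n)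
     (if k < n then sigma_x else sigma_y)"
  have len: "length ?js = n" by (simp add: jw_string_def)
  have js: "A \<in> {sigma_x, sigma_y, sigma_z, 1\<^sub>m 2}" if "A \<in> set ?js" for A
    using that by (auto simp: jw_string_def split: if_splits)
  show "spin_gen n (Suc k) \<in> carrier_mat (2 ^ n) (2 ^ n)"
    using kron_list_carrier[of ?js] js len by (fastforce simp: spin_gen_eq_jw_string)
  show "mat_adjoint (spin_gen n (Suc k)) = spin_gen n (Suc k)"
    unfolding spin_gen_eq_jw_string
    by (rule kron_list_adjoint) (use js in \<open>fastforce simp: sigma_adjoint mat_adjoint_one\<close>)
  show "spin_gen n (Suc k) * spin_gen n (Suc k) = 1\<^sub>m (2 ^ n)"
    unfolding spin_gen_eq_jw_string
    by (subst kron_list_square) (use js len in \<open>fastforce simp: sigma_square\<close>)+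
next
  \<comment> \<open>Different generators share a position only as \<open>sigma_x\<close> and
    \<open>sigma_y\<close>. Position \<open>n\<close> belongs to the last index alone, so the
    smaller of the two positions is below \<open>n\<close>.\<close>
  fix k l assume "k < 2 * n + 1" "l < 2 * n + 1" "k \<noteq> l"
  then show "spin_gen n (Suc k) * spin_gen n (Suc l) = - 1 \<cdot>\<^sub>m (spin_gen n (Suc l) * spin_gen n (Suc k))"
    unfolding spin_gen_eq_jw_string
    by (intro jw_string_anticommute) (auto intro: sigma_anticommute split: if_splits)
qed

subsection \<open>Orthogonal projections onto codes\<close>

lemma mat_eqI_mult_vec:
  fixes A B :: "'a :: semiring_1 mat"
  assumes "A \<in> carrier_mat n m" "B \<in> carrier_mat n m"
    and "\<And>v. v \<in> carrier_vec m \<Longrightarrow> A *\<^sub>v v = B *\<^sub>v v"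
  shows "A = B"
proof (rule eq_matI)
  fix i j assume ij: "i < dim_row B" "j < dim_col B"
  have "(A *\<^sub>v unit_vec m j) $ i = (B *\<^sub>v unit_vec m j) $ i"
    using assms(3) by simp
  then show "A $$ (i, j) = B $$ (i, j)" using ij assms(1,2) by simp
qed (use assms in auto)

lemma minus_vec_zeroD:
  fixes v w :: "'a :: group_add vec"
  assumes "v \<in> carrier_vec n" "w \<in> carrier_vec n" "v - w = 0\<^sub>v n"
  shows "v = w"
proof (rule eq_vecI)
  fix i assume "i < dim_vec w"
  then show "v $ i = w $ i"
    using arg_cong[OF assms(3), of "\<lambda>v. v $ i"] assms(1,2) by simp
qed (use assms in auto)

lemma cnj_cscalar_prod:
  fixes v w :: "complex vec"
  assumes "v \<in> carrier_vec n" "w \<in> carrier_vec n"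
  shows "cnj (v \<bullet>c w) = w \<bullet>c v"
  using conjugate_sprod_vec[of v n "conjugate w"] comm_scalar_prod[of "conjugate v" n w] assms
  by simp

context
  fixes N :: nat and C :: "complex vec set"
  assumes code: "quantum_code N C"
begin

interpretation V: vec_space "TYPE(complex)" N .

lemma code_submodule: "submodule class_ring C V.V"
  using code by (simp add: quantum_code_def VectorSpace.subspace_def)

lemma code_carrier: "C \<subseteq> carrier_vec N"
  using submodule.subset[OF code_submodule] by (simp add: module_vec_simps)

lemma code_diff:
  assumes "v \<in> C" "w \<in> C"
  shows "v - w \<in> C"
proof -
  have "v + (- 1) \<cdot>\<^sub>v w \<in> C"
    using submodule.m_closed[OF code_submodule assms(1) submodule.smult_closed[OF code_submodule _ assms(2), of "- 1"]]
    by (simp add: module_vec_simps)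
  moreover have "v + (- 1) \<cdot>\<^sub>v w = v - w"
    using assms code_carrier by (intro eq_vecI) auto
  ultimately show ?thesis by simp
qed

context
  fixes P :: "complex mat"
  assumes proj: "is_orth_proj N C P"
begin

lemma orth_proj_carrier [simp]: "P \<in> carrier_mat N N"
  using proj by (simp add: is_orth_proj_def)

lemma orth_proj_mult_vec_carrier [simp]: "v \<in> carrier_vec N \<Longrightarrow> P *\<^sub>v v \<in> carrier_vec N"
  by (rule mult_mat_vec_carrier) simp_all

lemma orth_proj_in: "v \<in> carrier_vec N \<Longrightarrow> P *\<^sub>v v \<in> C"
  using proj by (simp add: is_orth_proj_def)

lemma orth_proj_perp: "v \<in> carrier_vec N \<Longrightarrow> w \<in> C \<Longrightarrow> (v - P *\<^sub>v v) \<bullet>c w = 0"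
  using proj by (simp add: is_orth_proj_def)

text \<open>\<open>w - P *\<^sub>v w\<close> lies in the code and is orthogonal to it, hence
  orthogonal to itself.\<close>

lemma orth_proj_fixes:
  assumes "w \<in> C"
  shows "P *\<^sub>v w = w"
proof -
  have w [simp]: "w \<in> carrier_vec N" using assms code_carrier by blast
  have "(w - P *\<^sub>v w) \<bullet>c (w - P *\<^sub>v w) = 0"
    using assms by (intro orth_proj_perp code_diff orth_proj_in) auto
  then have 0: "w - P *\<^sub>v w = 0\<^sub>v N"
    by (subst (asm) conjugate_square_eq_0_vec[of _ N]) (auto intro!: minus_carrier_vec)
  show ?thesis
    by (rule minus_vec_zeroD[of _ N, OF _ _ 0, symmetric]) simp_all
qed

lemma orth_proj_idem: "P * P = P"
  by (rule mat_eqI_mult_vec[of _ N N])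
    (simp_all add: mult_carrier_mat[of _ N N] assoc_mult_mat_vec[of _ N N _ N] orth_proj_in orth_proj_fixes)

lemma orth_proj_adjoint: "mat_adjoint P = P"
proof -
  note [simp] = carrier_matD[OF orth_proj_carrier]
  \<comment> \<open>Both sides equal the inner product of \<open>P *\<^sub>v v\<close> with
    \<open>P *\<^sub>v w\<close>.\<close>
  have sym: "(P *\<^sub>v v) \<bullet>c w = v \<bullet>c (P *\<^sub>v w)"
    if [simp]: "v \<in> carrier_vec N" "w \<in> carrier_vec N" for v w
  proof -
    have "v \<bullet>c (P *\<^sub>v w) - (P *\<^sub>v v) \<bullet>c (P *\<^sub>v w) = 0"
      using orth_proj_perp[of v "P *\<^sub>v w"] orth_proj_in[of w]
      by (simp add: minus_scalar_prod_distrib[of _ N])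
    moreover have "w \<bullet>c (P *\<^sub>v v) - (P *\<^sub>v w) \<bullet>c (P *\<^sub>v v) = 0"
      using orth_proj_perp[of w "P *\<^sub>v v"] orth_proj_in[of v]
      by (simp add: minus_scalar_prod_distrib[of _ N])
    then have "cnj (w \<bullet>c (P *\<^sub>v v)) = cnj ((P *\<^sub>v w) \<bullet>c (P *\<^sub>v v))" by simp
    then have "(P *\<^sub>v v) \<bullet>c w = (P *\<^sub>v v) \<bullet>c (P *\<^sub>v w)"
      by (simp only: cnj_cscalar_prod[of _ N] that orth_proj_mult_vec_carrier)
    ultimately show ?thesis by simp
  qed
  show ?thesis
  proof (rule eq_matI)
    fix i j assume ij: "i < dim_row P" "j < dim_col P"
    have "(P *\<^sub>v unit_vec N i) \<bullet>c unit_vec N j = unit_vec N i \<bullet>c (P *\<^sub>v unit_vec N j)"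
      by (rule sym) simp_all
    moreover have "conjugate (unit_vec N j) = (unit_vec N j :: complex vec)"
      by (intro eq_vecI) (auto simp: unit_vec_def)
    ultimately have "P $$ (j, i) = cnj (P $$ (i, j))"
      using ij by simp
    then show "mat_adjoint P $$ (i, j) = P $$ (i, j)" using ij by simp
  qed simp_all
qed

text \<open>If the columns of \<open>B\<close> form a basis of \<open>C\<close>, then \<open>P = B * A\<close> for some \<open>A\<close> with \<open>A * B = 1\<close>,
  so that the trace of \<open>P\<close> is the size of \<open>A * B\<close>.\<close>

lemma mat_trace_orth_proj: "mat_trace P = of_nat (code_dim N C)"
proof -
  note [simp] = carrier_matD[OF orth_proj_carrier]
  \<comment> \<open>As the column space of \<open>P\<close>, the code is finite-dimensional.\<close>
  have "C = V.span (set (cols P))"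
    using orth_proj_in orth_proj_fixes code_carrier
    by (auto simp: V.col_space_eq[OF orth_proj_carrier, unfolded V.col_space_def] intro!: bexI)
  then have fd: "vectorspace.fin_dim class_ring (V.vs C)"
    using V.fin_dim_span_cols[OF orth_proj_carrier] by simp
  have vsC: "vectorspace class_ring (V.vs C)"
    using code V.subspace_is_vs by (simp add: quantum_code_def)
  obtain b where b: "finite b" "vectorspace.basis class_ring (V.vs C) b"
    using vectorspace.finite_basis_exists[OF vsC fd] by blast
  then have bC: "b \<subseteq> C" and spanb: "V.span b = C" and lib: "V.lin_indpt b"
    using V.span_li_not_depend[OF _ code_submodule, of b]
    by (auto simp: vectorspace.basis_def[OF vsC])
  define D where "D = code_dim N C"
  have "card b = D"
    using vectorspace.dim_basis[OF vsC b] by (simp add: D_def code_dim_def)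
  with b(1) obtain bs where bs: "set bs = b" "distinct bs" "length bs = D"
    by (metis distinct_card finite_distinct_list)
  define B where "B = mat_of_cols N bs"
  have B [simp]: "B \<in> carrier_mat N D" by (simp add: B_def bs(3)[symmetric])
  have colsB: "cols B = bs"
    using bs(1) bC code_carrier by (simp add: B_def)
  have "\<exists>x\<in>carrier_vec D. B *\<^sub>v x = v" if "v \<in> C" for v
    using that spanb V.col_space_eq[OF B] B by (auto simp: V.col_space_def colsB bs(1))
  then obtain f where f: "\<And>v. v \<in> C \<Longrightarrow> f v \<in> carrier_vec D \<and> B *\<^sub>v f v = v" by metis
  \<comment> \<open>The columns of \<open>A\<close> are the coordinates of the columns of
    \<open>P\<close> in the basis \<open>bs\<close>.\<close>
  define A where "A = mat_of_cols D (map (\<lambda>j. f (col P j)) [0..<N])"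
  have A [simp]: "A \<in> carrier_mat D N" by (intro carrier_matI) (simp_all add: A_def)
  have colP: "col P j \<in> C" if "j < N" for j
  proof -
    have "col P j = P *\<^sub>v unit_vec N j" using that by (intro eq_vecI) auto
    then show ?thesis using orth_proj_in[of "unit_vec N j"] by simp
  qed
  have BA: "B * A = P"
  proof (rule mat_col_eqI)
    fix j assume "j < dim_col P"
    then have j: "j < N" by simp
    then have "col A j = f (col P j)" using f[OF colP[OF j]] by (simp add: A_def)
    then show "col (B * A) j = col P j"
      using j f[OF colP[OF j]] by (simp add: col_mult2[of _ N D _ N])
  qed (use carrier_matD[OF A] carrier_matD[OF B] in auto)
  have PB: "P * B = B"
  proof (rule mat_col_eqI)
    fix j assume "j < dim_col B"
    then have j: "j < D" using B by simp
    then have "col B j \<in> C" using colsB bs bC B by (metis cols_nth carrier_matD(2) nth_mem subsetD)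
    then show "col (P * B) j = col B j"
      using j orth_proj_fixes by (simp add: col_mult2[of _ N N _ D])
  qed (use carrier_matD[OF B] in auto)
  have inj: "x = 0\<^sub>v D" if "x \<in> carrier_vec D" "B *\<^sub>v x = 0\<^sub>v N" for x
    using V.lin_depI[OF B that(1) _ that(2)] lib bs colsB by auto
  \<comment> \<open>\<open>B * A * B = P * B = B\<close>, and injectivity of \<open>B\<close>
    cancels the left factor.\<close>
  have AB: "A * B = 1\<^sub>m D"
  proof (rule mat_eqI_mult_vec[of _ D D])
    fix v :: "complex vec" assume v [simp]: "v \<in> carrier_vec D"
    have c [simp]: "A * B *\<^sub>v v \<in> carrier_vec D" "B *\<^sub>v v \<in> carrier_vec N"
      by (auto intro!: mult_mat_vec_carrier[of _ _ D] simp: mult_carrier_mat[of _ D N])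
    have "B *\<^sub>v (A * B *\<^sub>v v) = B * A * B *\<^sub>v v"
      by (simp add: assoc_mult_mat_vec[of _ N D _ D] assoc_mult_mat_vec[of _ D N _ D]
          assoc_mult_mat[of _ N D _ N _ D] mult_carrier_mat[of _ D N])
    also have "\<dots> = B *\<^sub>v v" by (simp add: BA PB del: assoc_mult_mat assoc_mult_mat_vec)
    finally have "B *\<^sub>v (A * B *\<^sub>v v - v) = 0\<^sub>v N"
      by (simp add: mult_minus_distrib_mat_vec[of _ N D])
    then have "A * B *\<^sub>v v - v = 0\<^sub>v D" by (intro inj minus_carrier_vec) simp_all
    then have "A * B *\<^sub>v v = v"
      by (rule minus_vec_zeroD[of _ D, rotated 2]) simp_all
    then show "A * B *\<^sub>v v = 1\<^sub>m D *\<^sub>v v" by simp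
  qed (simp_all add: mult_carrier_mat[of _ D N])
  have "mat_trace P = mat_trace (A * B)"
    using mat_trace_comm[OF A B] by (simp add: BA)
  then show ?thesis by (simp add: AB mat_trace_one D_def)
qed

end

text \<open>Each projection fixes the range of the other, and taking adjoints identifies the two
  products. Since \<open>detects\<close> chooses a projection for each operator separately, this
  lets one \<open>P\<close> serve all pairs.\<close>

lemma orth_proj_unique:
  assumes "is_orth_proj N C P" "is_orth_proj N C Q"
  shows "P = Q"
proof -
  note [simp] = orth_proj_carrier[OF assms(1)] orth_proj_carrier[OF assms(2)]
  have PQ: "P * Q = Q"
    using assms by (intro mat_eqI_mult_vec[of _ N N])
      (simp_all add: mult_carrier_mat[of _ N N] assoc_mult_mat_vec[of _ N N _ N] orth_proj_in orth_proj_fixes)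
  have "Q * P = P"
    using assms by (intro mat_eqI_mult_vec[of _ N N])
      (simp_all add: mult_carrier_mat[of _ N N] assoc_mult_mat_vec[of _ N N _ N] orth_proj_in orth_proj_fixes)
  then have "mat_adjoint (Q * P) = P" using assms orth_proj_adjoint by simp
  then have "P * Q = P" using assms by (simp add: mat_adjoint_mult[of _ N N _ N] orth_proj_adjoint)
  with PQ show ?thesis by simp
qed

end

section \<open>Spans of sets of matrices\<close>

lemma mat_span_superset:
  assumes "S \<subseteq> carrier_mat N N"
  shows "S \<subseteq> mat_span N S"
proof -
  interpret M: vectorspace "class_ring :: complex ring" "module_mat TYPE(complex) N N"
    by (rule matrix_vs)
  show ?thesis
    using M.in_own_span[of S] assms by (simp add: mat_span_def module_mat_simps)
qed

lemma mat_span_carrier: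
  assumes "S \<subseteq> carrier_mat N N"
  shows "mat_span N S \<subseteq> carrier_mat N N"
proof -
  interpret M: vectorspace "class_ring :: complex ring" "module_mat TYPE(complex) N N"
    by (rule matrix_vs)
  show ?thesis
    using M.span_is_subset2[of S] assms by (simp add: mat_span_def module_mat_simps)
qed

subsection \<open>The dimension bound\<close>

lemma mat_set_power_one_superset:
  assumes "S \<subseteq> carrier_mat N N"
  shows "S \<subseteq> mat_set_power N S 1"
proof -
  let ?T = "{foldr (*) As (1\<^sub>m N) | As. length As = 1 \<and> set As \<subseteq> S}"
  have "?T = S"
  proof (intro equalityI subsetI)
    fix A assume "A \<in> ?T"
    then show "A \<in> S" using assms by (auto simp: length_Suc_conv)
  next
    fix A assume "A \<in> S"
    then show "A \<in> ?T" using assms by (intro CollectI exI[of _ "[A]"]) auto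
  qed
  then show ?thesis using mat_span_superset[OF assms] by (simp add: mat_set_power_def)
qed

lemma spin_gen_prod_in_metric:
  assumes "1 \<le> k" "k < l" "l \<le> 2 * n + 1"
  shows "spin_gen n k * spin_gen n l \<in> spin_metric n 1"
proof -
  let ?S = "{1\<^sub>m (2 ^ n)} \<union> {spin_gen n k * spin_gen n l | k l. 1 \<le> k \<and> k < l \<and> l \<le> 2 * n + 1}"
  interpret clifford_family "2 ^ n" "2 * n + 1" "\<lambda>k. spin_gen n (Suc k)"
    by (rule spin_gen_clifford)
  have "spin_gen n k \<in> carrier_mat (2 ^ n) (2 ^ n)" if "1 \<le> k" for k
    using U_carrier[of "k - 1"] that by simp
  then have S: "?S \<subseteq> carrier_mat (2 ^ n) (2 ^ n)"
    by (auto intro!: mult_carrier_mat[of _ "2 ^ n" "2 ^ n"])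
  have "spin_gen n k * spin_gen n l \<in> spin_space n"
    using mat_span_superset[OF S] assms by (auto simp: spin_space_def)
  then show ?thesis
    using mat_set_power_one_superset[OF mat_span_carrier[OF S]]
    by (auto simp: spin_metric_def spin_space_def)
qed

theorem lemma3p5p10:
  fixes n :: nat and C :: "complex vec set"
  assumes "n \<ge> 3"
    and "quantum_code (2 ^ n) C"
    and "has_distance (2 ^ n) (spin_metric n) C 2"
  shows "real (code_dim (2 ^ n) C) \<le> 2 ^ (n - 1) / (real n + 1)"
proof (cases "code_dim (2 ^ n) C \<le> 1")
  case True
  \<comment> \<open>In dimension at most 1 it suffices that the right-hand side is at least 1, which
    is this inequality at \<open>m = n - 1\<close>.\<close>
  have "m + 2 \<le> 2 ^ m" if "2 \<le> m" for m :: nat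
    using that by (induct m rule: nat_induct_at_least) auto
  from this[of "n - 1"] have "n + 1 \<le> 2 ^ (n - 1)" using assms(1) by simp
  then have "real (n + 1) \<le> real (2 ^ (n - 1))" by (rule of_nat_mono)
  then have "1 \<le> 2 ^ (n - 1) / (real n + 1)" by (simp add: le_divide_eq add.commute)
  then show ?thesis using True by linarith
next
  case False
  interpret clifford_family "2 ^ n" "2 * n + 1" "\<lambda>k. spin_gen n (Suc k)"
    by (rule spin_gen_clifford)
  note code = assms(2)
  \<comment> \<open>Distance 2 gives detection of all of \<open>spin_metric n 1\<close>, where the
    products of two generators lie.\<close>
  have det: "detects (2 ^ n) C (spin_gen n (Suc k) * spin_gen n (Suc l))" if "k < l" "l < 2 * n + 1" for k l
    using assms(3) spin_gen_prod_in_metric[of "Suc k" "Suc l" n] that by (simp add: has_distance_def)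
  \<comment> \<open>Existence of the projection is part of the detection condition, so any single
    pair supplies it.\<close>
  obtain P where P: "is_orth_proj (2 ^ n) C P"
    using det[of 0 1] assms(1) by (auto simp: detects_def)
  have knill: "\<exists>c. P * (spin_gen n (Suc k) * spin_gen n (Suc l)) * P = c \<cdot>\<^sub>m P"
    if "k < l" "l < 2 * n + 1" for k l
    using det[OF that] orth_proj_unique[OF code P] by (metis detects_def)
  note idem = orth_proj_idem[OF code P] and adj = orth_proj_adjoint[OF code P]
  have dim: "hs_inner P P = real (code_dim (2 ^ n) C)"
    by (simp add: hs_inner_def idem adj mat_trace_orth_proj[OF code P])
  obtain s where s: "s \<ge> 0"
    "((real (2 * n + 1))\<^sup>2 - 1) * hs_inner P P / real (2 ^ n)
      + ((real (2 * n + 1) - 4)\<^sup>2 - 1) * hs_inner P P * s / real (2 ^ n) \<le> real (2 * n + 1) - 1 + 2 * s"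
    by (rule projection_trace_inequality[OF orth_proj_carrier[OF code P] idem adj])
      (use knill dim False in auto)
  \<comment> \<open>The remaining case has dimension at least 2, as the arithmetic demands for
    \<open>n = 3\<close>.\<close>
  have "2 \<le> real (code_dim (2 ^ n) C)" using False by linarith
  then show ?thesis
    using s dim by (intro dimension_bound_arith[OF assms(1) s(1)]) auto
qed

end
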